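(* Let $G=(V;E)$ be the random graph. For any closed monoid $\mathcal{M}$ of operations from $V$ to $V$ that contains $\mathrm{Aut}(G)$, one of the following cases applies. (1) $\mathcal{M}$ contains a constant operation. (2) $\mathcal{M}$ contains $e_E$. (3) $\mathcal{M}$ contains $e_N$. (4) The permutations in $\mathcal{M}$ form a group which is a dense subset of $\mathcal{M}$ in the space $V^V$.
   Context: Random graph: $G=(V;E)$ is the countably infinite (undirected, loopless) graph, unique up to isomorphism, such that for all finite disjoint $U,U'\subseteq V$ there is $v\in V\setminus(U\cup U')$ adjacent to all vertices in $U$ and to none in $U'$. $\mathrm{Aut}(G)$ is its automorphism group. A monoid of operations from $V$ to $V$ is a set of such operations containing the identity and closed under composition. It is closed iff it is a closed subset of $V^V$ in the pointwise convergence topology (basic open sets: all $f$ with $f|_A=s$, for $A\subseteq V$ finite and $s\colon A\to V$). $e_E\colon V\to V$ is a fixed injection whose image induces a complete subgraph of $G$; $e_N\colon V\to V$ is a fixed injection whose image induces an independent set in $G$. *)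

theory Defs
  imports "HOL-Analysis.Function_Topology" "HOL-Algebra.Group"
begin

text \<open>The vertex set is the whole type \<open>'v\<close>, so operations on \<open>V\<close> are the functions \<open>'v \<Rightarrow> 'v\<close>.\<close>

definition random_graph :: "('v \<Rightarrow> 'v \<Rightarrow> bool) \<Rightarrow> bool" where
  "random_graph E \<longleftrightarrow>
     countable (UNIV :: 'v set) \<and> infinite (UNIV :: 'v set) \<and>
     symp E \<and> irreflp E \<and>
     (\<forall>U U'. finite U \<longrightarrow> finite U' \<longrightarrow> U \<inter> U' = {} \<longrightarrow>
        (\<exists>v. v \<notin> U \<union> U' \<and> (\<forall>u\<in>U. E v u) \<and> (\<forall>u\<in>U'. \<not> E v u)))"

definition graph_automorphisms :: "('v \<Rightarrow> 'v \<Rightarrow> bool) \<Rightarrow> ('v \<Rightarrow> 'v) set" where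
  "graph_automorphisms E = {f. bij f \<and> (\<forall>x y. E x y \<longleftrightarrow> E (f x) (f y))}"

definition induces_complete :: "('v \<Rightarrow> 'v \<Rightarrow> bool) \<Rightarrow> 'v set \<Rightarrow> bool" where
  "induces_complete E S \<longleftrightarrow> (\<forall>x\<in>S. \<forall>y\<in>S. x \<noteq> y \<longrightarrow> E x y)"

definition independent_set :: "('v \<Rightarrow> 'v \<Rightarrow> bool) \<Rightarrow> 'v set \<Rightarrow> bool" where
  "independent_set E S \<longleftrightarrow> (\<forall>x\<in>S. \<forall>y\<in>S. \<not> E x y)"

definition operation_monoid :: "('v \<Rightarrow> 'v) set \<Rightarrow> bool" where
  "operation_monoid M \<longleftrightarrow> id \<in> M \<and> (\<forall>f\<in>M. \<forall>g\<in>M. f \<circ> g \<in> M)"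

text \<open>The topology of pointwise convergence on \<open>V\<^sup>V\<close>, with \<open>V\<close> discrete.\<close>

definition pointwise_topology :: "('v \<Rightarrow> 'v) topology" where
  "pointwise_topology = product_topology (\<lambda>_. discrete_topology UNIV) UNIV"

definition closed_operation_monoid :: "('v \<Rightarrow> 'v) set \<Rightarrow> bool" where
  "closed_operation_monoid M \<longleftrightarrow> operation_monoid M \<and> closedin pointwise_topology M"

definition permutations_in :: "('v \<Rightarrow> 'v) set \<Rightarrow> ('v \<Rightarrow> 'v) set" where
  "permutations_in M = {f \<in> M. bij f}"

definition forms_group :: "('v \<Rightarrow> 'v) set \<Rightarrow> bool" where
  "forms_group P \<longleftrightarrow> group \<lparr>carrier = P, mult = (\<circ>), one = id\<rparr>"

definition dense_subset :: "('v \<Rightarrow> 'v) set \<Rightarrow> ('v \<Rightarrow> 'v) set \<Rightarrow> bool" where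
  "dense_subset P M \<longleftrightarrow> P \<subseteq> M \<and> M \<subseteq> pointwise_topology closure_of P"

end

theory Submission
  imports Defs
begin

text \<open>
The dividing line is local invertibility: every operation of the monoid can be undone, on any given
finite set, by another operation of the monoid.

If \<open>M\<close> is locally invertible, a back-and-forth construction extends the restriction of any
\<open>h \<in> M\<close> to a finite set to a permutation all of whose finite restrictions come from \<open>M\<close>. As \<open>M\<close>
is closed, this permutation lies in \<open>M\<close>, so the permutations are dense; closedness in the same way
puts the inverse of every permutation of \<open>M\<close> into \<open>M\<close>.

If \<open>M\<close> is not locally invertible, fix a finite set \<open>A\<close> and \<open>h \<in> M\<close> that cannot be undone on \<open>A\<close>.
On any finite set \<open>Y\<close> some \<open>g \<in> M\<close> is recurrent: whatever \<open>M\<close> does to the image of \<open>g\<close> on \<open>Y\<close>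
can be undone by \<open>M\<close>. Indeed, up to automorphisms only finitely many images of \<open>Y\<close> occur, and one
can move to one from which the fewest others are reachable. The image of \<open>Y\<close> under a recurrent \<open>g\<close>
cannot contain a copy of the graph on \<open>A\<close>, since \<open>h\<close>, transported by an automorphism, would destroy
it irreversibly. Now colour the pairs \<open>x, y\<close> of \<open>Y\<close> by whether \<open>g x\<close> and \<open>g y\<close> are equal, adjacent
or distinct and nonadjacent. By a Ramsey theorem, if \<open>Y\<close> is large enough then it contains a copy of
any prescribed finite graph \<open>K\<close> on which the colour depends only on adjacency. If edges and nonedges
had different colours then either one of the two would be collapsed, which is impossible along an
induced path of length two (or the complement of one), or \<open>g\<close> would preserve or exchange edges
and nonedges, and
then the image would contain a copy of \<open>A\<close>, provided that \<open>K\<close> contains \<open>A\<close> and its complement.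
So \<open>g\<close> is constant on the copy of \<open>K\<close>, or injective with complete image, or injective with
independent image. One of the three alternatives occurs for all finite \<open>K\<close>, and homogeneity
together with closedness turns it into a constant, \<open>e_E\<close> or \<open>e_N\<close> in \<open>M\<close>.

The Ramsey theorem is the induced Ramsey theorem for edge colourings, applied once to the graph and
once to its complement. It is proved by an inductive construction: a graph is blown up
and new vertices are attached to it, so that a colouring without the wanted copies must leave intact
a copy of the old graph together with a new vertex joined by edges of the second colour only.
The main steps are \<open>random_graph_homogeneous\<close>, \<open>blow_up_step\<close>, \<open>induced_ramsey\<close>,
\<open>recurrent_operation\<close> and \<open>homogeneous_image\<close>.
\<close>

section \<open>Embeddings and homogeneity\<close>

definition graph_embedding ::
    "('a \<Rightarrow> 'a \<Rightarrow> bool) \<Rightarrow> ('b \<Rightarrow> 'b \<Rightarrow> bool) \<Rightarrow> 'a set \<Rightarrow> ('a \<Rightarrow> 'b) \<Rightarrow> bool" where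
  "graph_embedding R E X \<phi> \<longleftrightarrow>
     inj_on \<phi> X \<and> (\<forall>x\<in>X. \<forall>y\<in>X. R x y \<longleftrightarrow> E (\<phi> x) (\<phi> y))"

lemma random_graph_extension:
  assumes "random_graph E" "finite U" "finite U'" "U \<inter> U' = {}"
  obtains v where "v \<notin> U" "v \<notin> U'" "\<forall>u\<in>U. E v u" "\<forall>u\<in>U'. \<not> E v u"
proof -
  have "\<exists>v. v \<notin> U \<union> U' \<and> (\<forall>u\<in>U. E v u) \<and> (\<forall>u\<in>U'. \<not> E v u)"
    using assms by (simp add: random_graph_def)
  then show thesis using that by blast
qed

lemma random_graph_sym: "random_graph E \<Longrightarrow> E x y \<longleftrightarrow> E y x"
  unfolding random_graph_def by (auto dest: sympD)

lemma random_graph_irrefl: "random_graph E \<Longrightarrow> \<not> E x x"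
  unfolding random_graph_def by (auto dest: irreflpD)

text \<open>The extension property yields the image of one more vertex at a time. Allowing graphs on any type
of vertices means that finite graphs built abstractly, such as blow-ups, can be found among the
vertices of the random graph.\<close>

lemma random_graph_universal:
  assumes "random_graph E" "finite P" "symp R" "irreflp R"
  shows "\<exists>\<beta>. graph_embedding R E P \<beta>"
  using \<open>finite P\<close>
proof (induction P)
  case empty
  show ?case by (simp add: graph_embedding_def)
next
  case (insert p P)
  then obtain \<beta> where \<beta>: "inj_on \<beta> P" "\<And>x y. x \<in> P \<Longrightarrow> y \<in> P \<Longrightarrow> R x y \<longleftrightarrow> E (\<beta> x) (\<beta> y)"
    by (auto simp: graph_embedding_def)
  have disj: "\<beta> ` {q\<in>P. R p q} \<inter> \<beta> ` {q\<in>P. \<not> R p q} = {}"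
    using \<beta>(1) by (auto dest: inj_onD)
  have fin: "finite (\<beta> ` {q\<in>P. R p q})" "finite (\<beta> ` {q\<in>P. \<not> R p q})"
    using insert.hyps(1) by simp_all
  obtain v where "v \<notin> \<beta> ` {q\<in>P. R p q}" "v \<notin> \<beta> ` {q\<in>P. \<not> R p q}"
    "\<forall>u\<in>\<beta> ` {q\<in>P. R p q}. E v u" "\<forall>u\<in>\<beta> ` {q\<in>P. \<not> R p q}. \<not> E v u"
    by (rule random_graph_extension[OF assms(1) fin disj])
  then have v: "v \<notin> \<beta> ` P" "\<And>q. q \<in> P \<Longrightarrow> E v (\<beta> q) \<longleftrightarrow> R p q" by blast+
  have sym: "R x y \<longleftrightarrow> R y x" for x y using assms(3) by (auto dest: sympD)
  have irr: "\<not> R x x" for x using assms(4) by (auto dest: irreflpD)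
  have "graph_embedding R E (insert p P) (\<beta>(p := v))"
    using insert.hyps(2) v \<beta> random_graph_sym[OF assms(1)] random_graph_irrefl[OF assms(1)] sym irr
    unfolding graph_embedding_def by (auto simp: inj_on_def)
  then show ?case by (rule exI[of _ "\<beta>(p := v)"])
qed

text \<open>The admissible finite partial maps \<open>Q\<close> are left abstract because the construction serves twice: with
finite partial isomorphisms it gives homogeneity, with the finite restrictions of operations of a
locally invertible monoid it gives permutations in that monoid. The last conclusion, that
every finite part of the limit lies in an admissible map, is what transfers a property of the finite
stages to the limit.\<close>

lemma back_and_forth:
  fixes Q :: "('v \<times> 'v) set \<Rightarrow> bool"
  assumes count: "countable (UNIV :: 'v set)"
    and start: "Q p0"
    and func: "\<And>p x y z. Q p \<Longrightarrow> (x, y) \<in> p \<Longrightarrow> (x, z) \<in> p \<Longrightarrow> y = z"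
    and inje: "\<And>p x y z. Q p \<Longrightarrow> (x, z) \<in> p \<Longrightarrow> (y, z) \<in> p \<Longrightarrow> x = y"
    and forth: "\<And>p x. Q p \<Longrightarrow> \<exists>y. Q (insert (x, y) p)"
    and backward: "\<And>p y. Q p \<Longrightarrow> \<exists>x. Q (insert (x, y) p)"
  shows "\<exists>f. bij f \<and> (\<forall>(x, y)\<in>p0. f x = y) \<and>
             (\<forall>A. finite A \<longrightarrow> (\<exists>p. Q p \<and> (\<forall>a\<in>A. (a, f a) \<in> p)))"
proof -
  \<comment> \<open>Stage \<open>n\<close> puts the \<open>n\<close>th vertex into both the domain and the range.\<close>
  define e where "e = from_nat_into (UNIV :: 'v set)"
  have surj_e: "\<exists>n. e n = x" for x
    unfolding e_def using from_nat_into_surj[OF count, of x] by auto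
  have step: "\<exists>p'. (Q p' \<and> p0 \<subseteq> p') \<and> (p \<subseteq> p' \<and> e n \<in> Domain p' \<and> e n \<in> Range p')"
    if p: "Q p \<and> p0 \<subseteq> p" for p n
  proof -
    obtain y where y: "Q (insert (e n, y) p)" using forth p by blast
    obtain x where "Q (insert (x, e n) (insert (e n, y) p))" using backward[OF y] by blast
    then show ?thesis using p by blast
  qed
  have "\<exists>s. \<forall>n. (Q (s n) \<and> p0 \<subseteq> s n) \<and>
          (s n \<subseteq> s (Suc n) \<and> e n \<in> Domain (s (Suc n)) \<and> e n \<in> Range (s (Suc n)))"
    by (rule dependent_nat_choice) (use start step in auto)
  then obtain s where "\<forall>n. (Q (s n) \<and> p0 \<subseteq> s n) \<and>
          (s n \<subseteq> s (Suc n) \<and> e n \<in> Domain (s (Suc n)) \<and> e n \<in> Range (s (Suc n)))" ..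
  then have s: "\<And>n. Q (s n)" "\<And>n. p0 \<subseteq> s n" "\<And>n. s n \<subseteq> s (Suc n)"
      "\<And>n. e n \<in> Domain (s (Suc n))" "\<And>n. e n \<in> Range (s (Suc n))" by simp_all
  have mono: "m \<le> n \<Longrightarrow> s m \<subseteq> s n" for m n using s(3) by (rule lift_Suc_mono_le)
  define S where "S = (\<Union>n. s n)"
  have common: "\<exists>n. a \<in> s n \<and> b \<in> s n" if ab: "a \<in> S" "b \<in> S" for a b
  proof -
    obtain k l where "a \<in> s k" "b \<in> s l" using ab by (auto simp: S_def)
    then show ?thesis using mono[of k "max k l"] mono[of l "max k l"] by auto
  qed
  have tot: "\<exists>y. (x, y) \<in> S" for x using surj_e[of x] s(4) unfolding S_def by blast
  have sur: "\<exists>x. (x, y) \<in> S" for y using surj_e[of y] s(5) unfolding S_def by blast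
  have fS: "(x, y) \<in> S \<Longrightarrow> (x, z) \<in> S \<Longrightarrow> y = z" for x y z
    using common func s(1) by blast
  have iS: "(x, z) \<in> S \<Longrightarrow> (y, z) \<in> S \<Longrightarrow> x = y" for x y z
    using common inje s(1) by blast
  obtain f where f: "\<And>x. (x, f x) \<in> S" using tot by metis
  have "bij f"
    by (rule bijI) (auto intro!: injI intro: iS f simp: surj_def, metis f iS, metis f fS sur)
  moreover have "\<forall>(x, y)\<in>p0. f x = y"
    using f fS s(2)[of 0] unfolding S_def by blast
  moreover have "\<exists>p. Q p \<and> (\<forall>a\<in>A. (a, f a) \<in> p)" if "finite A" for A
  proof -
    have "\<exists>n. \<forall>a\<in>A. (a, f a) \<in> s n"
      using that
    proof (induction A)
      case (insert b A)
      then obtain n m where "\<forall>a\<in>A. (a, f a) \<in> s n" "(b, f b) \<in> s m"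
        using f[of b] by (auto simp: S_def)
      then show ?case using mono[of n "max n m"] mono[of m "max n m"]
        by (intro exI[of _ "max n m"]) auto
    qed simp
    then show ?thesis using s(1) by blast
  qed
  ultimately show ?thesis by blast
qed

definition finite_partial_iso :: "('v \<Rightarrow> 'v \<Rightarrow> bool) \<Rightarrow> ('v \<times> 'v) set \<Rightarrow> bool" where
  "finite_partial_iso E p \<longleftrightarrow> finite p \<and>
     (\<forall>x y x' y'. (x, y) \<in> p \<longrightarrow> (x', y') \<in> p \<longrightarrow> (x = x' \<longleftrightarrow> y = y') \<and> (E x x' \<longleftrightarrow> E y y'))"

lemma finite_partial_iso_converse:
  "finite_partial_iso E (p\<inverse>) \<longleftrightarrow> finite_partial_iso E p"
  unfolding finite_partial_iso_def by simp blast

text \<open>The constraints on the image of \<open>x\<close> come from finitely many vertices, and \<open>p\<close> being a partial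
isomorphism makes them consistent.\<close>

lemma finite_partial_iso_forth:
  assumes E: "random_graph E" and p: "finite_partial_iso E p"
  shows "\<exists>y. finite_partial_iso E (insert (x, y) p)"
proof (cases "x \<in> Domain p")
  case True
  then obtain y where "(x, y) \<in> p" by blast
  then have "insert (x, y) p = p" by auto
  then show ?thesis using p by metis
next
  case False
  have fin: "finite p" and
    iso: "\<And>a b a' b'. (a, b) \<in> p \<Longrightarrow> (a', b') \<in> p \<Longrightarrow> (a = a' \<longleftrightarrow> b = b') \<and> (E a a' \<longleftrightarrow> E b b')"
    using p unfolding finite_partial_iso_def by blast+
  define U U' where "U = {b. \<exists>a. (a, b) \<in> p \<and> E x a}" and "U' = {b. \<exists>a. (a, b) \<in> p \<and> \<not> E x a}"
  have disj: "U \<inter> U' = {}" using iso unfolding U_def U'_def by blast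
  have "U \<subseteq> snd ` p" "U' \<subseteq> snd ` p" unfolding U_def U'_def by force+
  then have "finite U" "finite U'" using fin by (meson finite_imageI finite_subset)+
  then obtain v where "v \<notin> U" "v \<notin> U'" "\<forall>u\<in>U. E v u" "\<forall>u\<in>U'. \<not> E v u"
    using disj by (rule random_graph_extension[OF E])
  then have v: "v \<noteq> b \<and> (E x a \<longleftrightarrow> E v b)" if "(a, b) \<in> p" for a b
    using that unfolding U_def U'_def by blast
  have new: "(x = a \<longleftrightarrow> v = b) \<and> (a = x \<longleftrightarrow> b = v) \<and> (E x a \<longleftrightarrow> E v b) \<and> (E a x \<longleftrightarrow> E b v)"
    if "(a, b) \<in> p" for a b
    using v[OF that] that False random_graph_sym[OF E] by auto
  have "finite_partial_iso E (insert (x, v) p)"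
    unfolding finite_partial_iso_def
    using fin iso new random_graph_irrefl[OF E] by simp
  then show ?thesis ..
qed

text \<open>Homogeneity, stated for two enumerations \<open>g, g'\<close> of finite tuples that may have repetitions:
this is the form in which operations of a monoid, which need not be injective, are compared.\<close>

lemma random_graph_homogeneous:
  assumes E: "random_graph E" and "finite X"
    and eq: "\<And>x y. x \<in> X \<Longrightarrow> y \<in> X \<Longrightarrow> g x = g y \<longleftrightarrow> g' x = g' y"
    and ed: "\<And>x y. x \<in> X \<Longrightarrow> y \<in> X \<Longrightarrow> E (g x) (g y) \<longleftrightarrow> E (g' x) (g' y)"
  shows "\<exists>\<alpha>\<in>graph_automorphisms E. \<forall>x\<in>X. \<alpha> (g x) = g' x"
proof -
  let ?p = "(\<lambda>x. (g x, g' x)) ` X"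
  have start: "finite_partial_iso E ?p"
    using assms unfolding finite_partial_iso_def by auto
  have "\<exists>f. bij f \<and> (\<forall>(x, y)\<in>?p. f x = y) \<and>
     (\<forall>A. finite A \<longrightarrow> (\<exists>p. finite_partial_iso E p \<and> (\<forall>a\<in>A. (a, f a) \<in> p)))"
  proof (rule back_and_forth[of "finite_partial_iso E" ?p])
    show "countable (UNIV :: 'a set)" using E by (simp add: random_graph_def)
    show "\<exists>y. finite_partial_iso E (insert (x, y) p)" if "finite_partial_iso E p" for p x
      using finite_partial_iso_forth[OF E that] .
    show "\<exists>x. finite_partial_iso E (insert (x, y) p)" if p: "finite_partial_iso E p" for p y
    proof -
      obtain x where "finite_partial_iso E (insert (y, x) (p\<inverse>))"
        using finite_partial_iso_forth[OF E, of "p\<inverse>" y] p finite_partial_iso_converse by metis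
      moreover have "(insert (x, y) p)\<inverse> = insert (y, x) (p\<inverse>)" by auto
      ultimately have "finite_partial_iso E ((insert (x, y) p)\<inverse>)" by simp
      then show ?thesis using finite_partial_iso_converse by blast
    qed
    show "y = z" if "finite_partial_iso E p" "(x, y) \<in> p" "(x, z) \<in> p" for p x y z
      using that unfolding finite_partial_iso_def by blast
    show "x = y" if "finite_partial_iso E p" "(x, z) \<in> p" "(y, z) \<in> p" for p x y z
      using that unfolding finite_partial_iso_def by blast
  qed (fact start)
  then obtain f where f: "bij f" "\<forall>x\<in>X. f (g x) = g' x"
    "\<And>A. finite A \<Longrightarrow> \<exists>p. finite_partial_iso E p \<and> (\<forall>a\<in>A. (a, f a) \<in> p)"
    by auto
  have "E x y \<longleftrightarrow> E (f x) (f y)" for x y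
    using f(3)[of "{x, y}"] unfolding finite_partial_iso_def by simp blast
  then show ?thesis using f by (auto simp: graph_automorphisms_def)
qed

section \<open>The induced Ramsey theorem\<close>

text \<open>The host graph is throughout the random graph itself: a finite graph is a finite set of vertices with
the induced edges. Colourings \<open>c\<close> are defined on all pairs of vertices, but only their values
on edges matter. In a two-colouring, an edge is red if \<open>c\<close> holds and blue otherwise.\<close>

definition mono_copy ::
    "('v \<Rightarrow> 'v \<Rightarrow> bool) \<Rightarrow> 'v set \<Rightarrow> 'v set \<Rightarrow> ('v \<Rightarrow> 'v \<Rightarrow> bool) \<Rightarrow> bool" where
  "mono_copy E Y H c \<longleftrightarrow> (\<exists>\<phi>. graph_embedding E E H \<phi> \<and> \<phi> ` H \<subseteq> Y \<and>
     (\<forall>x\<in>H. \<forall>y\<in>H. E x y \<longrightarrow> c (\<phi> x) (\<phi> y)))"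

definition arrows :: "('v \<Rightarrow> 'v \<Rightarrow> bool) \<Rightarrow> 'v set \<Rightarrow> 'v set \<Rightarrow> 'v set \<Rightarrow> bool" where
  "arrows E Y H1 H2 \<longleftrightarrow>
     (\<forall>c. symp c \<longrightarrow> mono_copy E Y H1 c \<or> mono_copy E Y H2 (\<lambda>x y. \<not> c x y))"

lemma arrowsD:
  "arrows E Y H1 H2 \<Longrightarrow> symp c \<Longrightarrow> \<not> mono_copy E Y H1 c \<Longrightarrow> mono_copy E Y H2 (\<lambda>x y. \<not> c x y)"
  unfolding arrows_def by blast

lemma graph_embedding_comp:
  assumes "graph_embedding R E X \<phi>" "\<phi> ` X \<subseteq> Y" "graph_embedding E F Y \<psi>"
  shows "graph_embedding R F X (\<psi> \<circ> \<phi>)"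
  using assms unfolding graph_embedding_def
  by (auto simp: inj_on_def image_subset_iff)

lemma mono_copy_transfer:
  assumes "mono_copy E Y H (\<lambda>x y. c (\<psi> x) (\<psi> y))" "graph_embedding E E Y \<psi>" "\<psi> ` Y \<subseteq> Z"
  shows "mono_copy E Z H c"
proof -
  obtain \<phi> where \<phi>: "graph_embedding E E H \<phi>" "\<phi> ` H \<subseteq> Y"
    "\<forall>x\<in>H. \<forall>y\<in>H. E x y \<longrightarrow> c (\<psi> (\<phi> x)) (\<psi> (\<phi> y))"
    using assms(1) unfolding mono_copy_def by blast
  then show ?thesis
    using graph_embedding_comp[OF \<phi>(1,2) assms(2)] assms(3) unfolding mono_copy_def
    by (intro exI[of _ "\<psi> \<circ> \<phi>"]) (auto simp: image_subset_iff)
qed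

text \<open>A monochromatic copy of \<open>H\<close> grows by one vertex if some \<open>x\<close> has the right neighbours in the copy and
all its edges there have the right colour.\<close>

lemma mono_copy_insert:
  assumes E: "random_graph E" and "symp c"
    and \<phi>: "graph_embedding E E H \<phi>" "\<phi> ` H \<subseteq> Y" "\<And>x y. x \<in> H \<Longrightarrow> y \<in> H \<Longrightarrow> E x y \<Longrightarrow> c (\<phi> x) (\<phi> y)"
    and x: "x \<in> Y" "x \<notin> \<phi> ` H" "v \<notin> H"
    and adj: "\<And>h. h \<in> H \<Longrightarrow> E x (\<phi> h) \<longleftrightarrow> E v h"
    and col: "\<And>h. h \<in> H \<Longrightarrow> E v h \<Longrightarrow> c x (\<phi> h)"
  shows "mono_copy E Y (insert v H) c"
proof -
  note [simp] = random_graph_irrefl[OF E]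
  have sym: "c a b \<longleftrightarrow> c b a" for a b using \<open>symp c\<close> by (auto dest: sympD)
  have "graph_embedding E E (insert v H) (\<phi>(v := x))"
    using \<phi>(1) x(2,3) adj random_graph_sym[OF E]
    unfolding graph_embedding_def inj_on_def by auto
  moreover have "(\<phi>(v := x)) ` insert v H \<subseteq> Y" using \<phi>(2) x by auto
  moreover have "\<forall>a\<in>insert v H. \<forall>b\<in>insert v H. E a b \<longrightarrow> c ((\<phi>(v := x)) a) ((\<phi>(v := x)) b)"
    using \<phi>(3) x(3) col sym random_graph_sym[OF E] by auto
  ultimately show ?thesis unfolding mono_copy_def by blast
qed

lemma vertices_with_all_traces:
  assumes E: "random_graph E" and Z: "finite Z"
  shows "\<exists>x. \<forall>S\<subseteq>Z. x S \<notin> Z \<and> (\<forall>z\<in>Z. E (x S) z \<longleftrightarrow> z \<in> S)"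
proof -
  have "\<exists>x. x \<notin> Z \<and> (\<forall>z\<in>Z. E x z \<longleftrightarrow> z \<in> S)" if S: "S \<subseteq> Z" for S
  proof -
    have "finite S" "finite (Z - S)" "S \<inter> (Z - S) = {}" using finite_subset[OF S Z] Z by auto
    then obtain v where "v \<notin> S" "v \<notin> Z - S" "\<forall>u\<in>S. E v u" "\<forall>u\<in>Z - S. \<not> E v u"
      by (rule random_graph_extension[OF E])
    then show ?thesis by blast
  qed
  then show ?thesis by metis
qed

text \<open>The neighbours of \<open>x\<close> inside the copy \<open>\<psi> ` X\<close> are exactly the images of the elements of \<open>T\<close>, and
\<open>x\<close> is joined to them by blue edges only.\<close>

definition blue_neighbour ::
    "('v \<Rightarrow> 'v \<Rightarrow> bool) \<Rightarrow> 'v set \<Rightarrow> ('v \<Rightarrow> 'v) \<Rightarrow> 'v set \<Rightarrow> ('v \<Rightarrow> 'v \<Rightarrow> bool) \<Rightarrow> 'v \<Rightarrow> bool" where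
  "blue_neighbour E X \<psi> T c x \<longleftrightarrow> x \<notin> \<psi> ` X \<and> (\<forall>u\<in>X. E x (\<psi> u) \<longleftrightarrow> u \<in> T) \<and>
     (\<forall>u\<in>X. u \<in> T \<longrightarrow> \<not> c x (\<psi> u))"

text \<open>Vertices carry labels so that the construction can be iterated: a set of vertices of \<open>X\<close> is
prescribed as the set of vertices with labels in \<open>T\<close>, which still makes sense in any larger graph
that contains label-preserving copies of \<open>X\<close>.\<close>

definition forces_blue_neighbours ::
    "('v \<Rightarrow> 'v \<Rightarrow> bool) \<Rightarrow> 'v set \<Rightarrow> 'v set \<Rightarrow> 'v set \<Rightarrow> ('v \<Rightarrow> 'v) \<Rightarrow> 'v set \<Rightarrow> ('v \<Rightarrow> 'v) \<Rightarrow>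
      'v set set \<Rightarrow> bool" where
  "forces_blue_neighbours E H1 H2 Z lab' X lab \<T> \<longleftrightarrow>
     (\<forall>c. symp c \<longrightarrow> \<not> mono_copy E Z H1 c \<longrightarrow> \<not> mono_copy E Z H2 (\<lambda>x y. \<not> c x y) \<longrightarrow>
       (\<exists>\<psi>. graph_embedding E E X \<psi> \<and> \<psi> ` X \<subseteq> Z \<and> (\<forall>u\<in>X. lab' (\<psi> u) = lab u) \<and>
          (\<forall>T\<in>\<T>. \<exists>x\<in>Z. blue_neighbour E X \<psi> {u. lab u \<in> T} c x)))"

lemma forces_blue_neighboursI:
  assumes "\<And>c. symp c \<Longrightarrow> \<not> mono_copy E Z H1 c \<Longrightarrow> \<not> mono_copy E Z H2 (\<lambda>x y. \<not> c x y) \<Longrightarrow>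
       \<exists>\<psi>. graph_embedding E E X \<psi> \<and> \<psi> ` X \<subseteq> Z \<and> (\<forall>u\<in>X. lab' (\<psi> u) = lab u) \<and>
          (\<forall>T\<in>\<T>. \<exists>x\<in>Z. blue_neighbour E X \<psi> {u. lab u \<in> T} c x)"
  shows "forces_blue_neighbours E H1 H2 Z lab' X lab \<T>"
  unfolding forces_blue_neighbours_def by (intro allI impI) (rule assms)

lemma forces_blue_neighboursE:
  assumes "forces_blue_neighbours E H1 H2 Z lab' X lab \<T>"
    and "symp c" "\<not> mono_copy E Z H1 c" "\<not> mono_copy E Z H2 (\<lambda>x y. \<not> c x y)"
  obtains \<psi> where "graph_embedding E E X \<psi>" "\<psi> ` X \<subseteq> Z" "\<forall>u\<in>X. lab' (\<psi> u) = lab u"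
    "\<forall>T\<in>\<T>. \<exists>x\<in>Z. blue_neighbour E X \<psi> {u. lab u \<in> T} c x"
proof -
  have "\<exists>\<psi>. graph_embedding E E X \<psi> \<and> \<psi> ` X \<subseteq> Z \<and> (\<forall>u\<in>X. lab' (\<psi> u) = lab u) \<and>
          (\<forall>T\<in>\<T>. \<exists>x\<in>Z. blue_neighbour E X \<psi> {u. lab u \<in> T} c x)"
    using assms(1)[unfolded forces_blue_neighbours_def, rule_format, OF assms(2-4)] .
  then show thesis by (elim exE conjE) (rule that, auto)
qed

text \<open>Replace every vertex \<open>u\<close> of \<open>X\<close> by a copy of \<open>Y\<close>, completely joined to the copies of the neighbours
of \<open>u\<close>, and add for every subset \<open>S\<close> of the result a vertex \<open>\<xi> S\<close> adjacent to exactly \<open>S\<close>. If there is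
no blue \<open>H2\<close>, every copy of \<open>Y\<close> contains a red \<open>H1\<close>. Let \<open>S\<close> collect, over all \<open>u\<close> with label in \<open>T\<close>,
the vertices of these red copies that correspond to neighbours of \<open>v\<close>. If for some \<open>u\<close> all edges from
\<open>\<xi> S\<close> to its share of \<open>S\<close> are red, then \<open>\<xi> S\<close> completes the red \<open>H1\<close> of that \<open>u\<close> to a red
\<open>insert v H1\<close>. Otherwise every such \<open>u\<close> has a vertex in its copy of \<open>Y\<close> joined to \<open>\<xi> S\<close> by a blue edge,
and any choice of one vertex from each copy of \<open>Y\<close> is a copy of \<open>X\<close>.\<close>

lemma blow_up_step:
  fixes lab :: "'v \<Rightarrow> 'v"
  assumes E: "random_graph E" and v: "v \<notin> H1"
    and Y: "finite Y" "arrows E Y H1 H2" and X: "finite X"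
  shows "\<exists>Z lab'. finite Z \<and> forces_blue_neighbours E (insert v H1) H2 Z lab' X lab {T}"
proof -
  note sym = random_graph_sym[OF E] and irr[simp] = random_graph_irrefl[OF E]
  \<comment> \<open>The set \<open>Y\<close> may be empty, so a vertex is added to make a choice from every fibre possible.\<close>
  define a :: 'v where "a = undefined"
  define B where "B = X \<times> insert a Y"
  have finB: "finite B" using X Y by (simp add: B_def)
  define R where "R = (\<lambda>(u, y) (u', y'). E u u' \<or> u = u' \<and> E y y')"
  have "symp R" "irreflp R" using sym by (auto simp: R_def symp_def irreflp_def)
  then obtain \<beta> where "graph_embedding R E B \<beta>"
    using random_graph_universal[OF E finB] by blast
  then have inj: "inj_on \<beta> B"
    and adj: "\<And>u y u' y'. (u, y) \<in> B \<Longrightarrow> (u', y') \<in> B \<Longrightarrow>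
                 E (\<beta> (u, y)) (\<beta> (u', y')) \<longleftrightarrow> E u u' \<or> u = u' \<and> E y y'"
    by (auto simp: graph_embedding_def R_def)
  have finZ: "finite (\<beta> ` B)" using finB by simp
  obtain \<xi> where \<xi>: "\<And>S. S \<subseteq> \<beta> ` B \<Longrightarrow> \<xi> S \<notin> \<beta> ` B"
      "\<And>S z. S \<subseteq> \<beta> ` B \<Longrightarrow> z \<in> \<beta> ` B \<Longrightarrow> E (\<xi> S) z \<longleftrightarrow> z \<in> S"
    using vertices_with_all_traces[OF E finZ] by metis
  define Z where "Z = \<beta> ` B \<union> \<xi> ` Pow (\<beta> ` B)"
  define lab' where "lab' = (\<lambda>z. lab (fst (inv_into B \<beta> z)))"
  have lab': "lab' (\<beta> (u, y)) = lab u" if "(u, y) \<in> B" for u y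
    using inv_into_f_f[OF inj that] by (simp add: lab'_def)
  have finZ': "finite Z" using finZ by (simp add: Z_def)
  have "\<exists>\<psi>. graph_embedding E E X \<psi> \<and> \<psi> ` X \<subseteq> Z \<and> (\<forall>u\<in>X. lab' (\<psi> u) = lab u) \<and>
     (\<forall>T\<in>{T}. \<exists>x\<in>Z. blue_neighbour E X \<psi> {u. lab u \<in> T} c x)"
    if c: "symp c" and no_red: "\<not> mono_copy E Z (insert v H1) c"
      and no_blue: "\<not> mono_copy E Z H2 (\<lambda>x y. \<not> c x y)" for c
  proof -
    have fibre: "graph_embedding E E Y (\<lambda>y. \<beta> (u, y))" "(\<lambda>y. \<beta> (u, y)) ` Y \<subseteq> Z" if "u \<in> X" for u
      using that adj inj unfolding graph_embedding_def inj_on_def B_def Z_def by auto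
    have "mono_copy E Y H1 (\<lambda>y y'. c (\<beta> (u, y)) (\<beta> (u, y')))" if u: "u \<in> X" for u
    proof -
      have "symp (\<lambda>y y'. c (\<beta> (u, y)) (\<beta> (u, y')))" using c by (auto simp: symp_def)
      moreover have "\<not> mono_copy E Y H2 (\<lambda>y y'. \<not> c (\<beta> (u, y)) (\<beta> (u, y')))"
        by (rule contrapos_nn[OF no_blue]) (rule mono_copy_transfer[OF _ fibre[OF u]])
      ultimately show ?thesis
        using Y(2)[unfolded arrows_def, THEN spec, of "\<lambda>y y'. c (\<beta> (u, y)) (\<beta> (u, y'))"] by simp
    qed
    then obtain \<phi> where \<phi>: "\<And>u. u \<in> X \<Longrightarrow> graph_embedding E E H1 (\<phi> u)" "\<And>u. u \<in> X \<Longrightarrow> \<phi> u ` H1 \<subseteq> Y"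
      "\<And>u h h'. u \<in> X \<Longrightarrow> h \<in> H1 \<Longrightarrow> h' \<in> H1 \<Longrightarrow> E h h' \<Longrightarrow> c (\<beta> (u, \<phi> u h)) (\<beta> (u, \<phi> u h'))"
      unfolding mono_copy_def by metis
    have inB: "(u, \<phi> u h) \<in> B" if "u \<in> X" "h \<in> H1" for u h using that \<phi>(2) by (auto simp: B_def)
    \<comment> \<open>This is the neighbourhood that decides which of the new vertices is used.\<close>
    define S where "S = {\<beta> (u, \<phi> u h) |u h. u \<in> X \<and> lab u \<in> T \<and> h \<in> H1 \<and> E v h}"
    have S: "S \<subseteq> \<beta> ` B" using inB by (auto simp: S_def)
    have S_iff: "\<beta> (u, y) \<in> S \<longleftrightarrow> lab u \<in> T \<and> (\<exists>h\<in>H1. E v h \<and> y = \<phi> u h)" if "(u, y) \<in> B" for u y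
    proof -
      have "\<beta> (u, y) = \<beta> (u', \<phi> u' h) \<longleftrightarrow> u = u' \<and> y = \<phi> u' h" if "u' \<in> X" "h \<in> H1" for u' h
        using inj_on_eq_iff[OF inj \<open>(u, y) \<in> B\<close> inB[OF that]] by auto
      then show ?thesis using that unfolding S_def B_def by auto
    qed
    have xZ: "\<xi> S \<in> Z" using S by (auto simp: Z_def)
    have none: "\<not> (\<forall>h\<in>H1. E v h \<longrightarrow> c (\<xi> S) (\<beta> (u, \<phi> u h)))"
      if u: "u \<in> X" "lab u \<in> T" for u
    proof
      assume col: "\<forall>h\<in>H1. E v h \<longrightarrow> c (\<xi> S) (\<beta> (u, \<phi> u h))"
      have "mono_copy E Z (insert v H1) c"
      proof (rule mono_copy_insert[OF E c, of _ "\<lambda>h. \<beta> (u, \<phi> u h)" _ "\<xi> S"])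
        show "graph_embedding E E H1 (\<lambda>h. \<beta> (u, \<phi> u h))"
          using graph_embedding_comp[OF \<phi>(1,2)[OF u(1)] fibre(1)[OF u(1)]] by (simp add: comp_def)
        show "(\<lambda>h. \<beta> (u, \<phi> u h)) ` H1 \<subseteq> Z" using inB[OF u(1)] by (auto simp: Z_def)
        show "\<xi> S \<notin> (\<lambda>h. \<beta> (u, \<phi> u h)) ` H1" using \<xi>(1)[OF S] inB[OF u(1)] by auto
        show "E (\<xi> S) (\<beta> (u, \<phi> u h)) \<longleftrightarrow> E v h" if "h \<in> H1" for h
          using \<xi>(2)[OF S] inB[OF u(1) that] S_iff[OF inB[OF u(1) that]] u(2) that \<phi>(1)[OF u(1)]
          unfolding graph_embedding_def inj_on_def by auto
      qed (use \<phi>(3) u col xZ v in auto)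
      then show False using no_red by blast
    qed
    then have "\<forall>u. \<exists>h. u \<in> X \<and> lab u \<in> T \<longrightarrow> h \<in> H1 \<and> E v h \<and> \<not> c (\<xi> S) (\<beta> (u, \<phi> u h))" by blast
    then obtain \<eta> where \<eta>: "\<And>u. u \<in> X \<Longrightarrow> lab u \<in> T \<Longrightarrow>
        \<eta> u \<in> H1 \<and> E v (\<eta> u) \<and> \<not> c (\<xi> S) (\<beta> (u, \<phi> u (\<eta> u)))" by metis
    define y where "y u = (if lab u \<in> T then \<phi> u (\<eta> u) else a)" for u
    have yB: "(u, y u) \<in> B" if "u \<in> X" for u using that \<eta> inB by (auto simp: y_def B_def)
    have "inj_on (\<lambda>u. \<beta> (u, y u)) X"
    proof (rule inj_onI)
      fix u u' assume "u \<in> X" "u' \<in> X" "\<beta> (u, y u) = \<beta> (u', y u')"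
      then have "(u, y u) = (u', y u')" using inj_onD[OF inj] yB by blast
      then show "u = u'" by simp
    qed
    moreover have "E u u' \<longleftrightarrow> E (\<beta> (u, y u)) (\<beta> (u', y u'))" if "u \<in> X" "u' \<in> X" for u u'
      unfolding adj[OF yB[OF that(1)] yB[OF that(2)]] by auto
    ultimately have "graph_embedding E E X (\<lambda>u. \<beta> (u, y u))"
      unfolding graph_embedding_def by blast
    moreover have "(\<lambda>u. \<beta> (u, y u)) ` X \<subseteq> Z" using yB by (auto simp: Z_def)
    moreover have "\<forall>u\<in>X. lab' (\<beta> (u, y u)) = lab u" using lab' yB by blast
    moreover have "blue_neighbour E X (\<lambda>u. \<beta> (u, y u)) {u. lab u \<in> T} c (\<xi> S)"
      unfolding blue_neighbour_def
    proof (intro conjI ballI impI)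
      show "\<xi> S \<notin> (\<lambda>u. \<beta> (u, y u)) ` X" using \<xi>(1)[OF S] yB by auto
      fix u assume u: "u \<in> X"
      show "E (\<xi> S) (\<beta> (u, y u)) \<longleftrightarrow> u \<in> {u. lab u \<in> T}"
        using \<xi>(2)[OF S] yB[OF u] S_iff[OF yB[OF u]] \<eta>[OF u] by (auto simp: y_def)
      show "\<not> c (\<xi> S) (\<beta> (u, y u))" if "u \<in> {u. lab u \<in> T}"
        using that \<eta>[OF u] by (auto simp: y_def)
    qed
    ultimately show ?thesis using xZ by blast
  qed
  then have "forces_blue_neighbours E (insert v H1) H2 Z lab' X lab {T}"
    by (rule forces_blue_neighboursI)
  then show ?thesis using finZ' by blast
qed

text \<open>Each step blows up the graph obtained so far. The vertices attached in earlier steps survive inside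
the copy of that graph, and the labels ensure that the vertex attached last has the prescribed
neighbours in the copy of \<open>X\<close> as well.\<close>

lemma blow_up_iterated:
  fixes lab :: "'v \<Rightarrow> 'v"
  assumes E: "random_graph E" and v: "v \<notin> H1"
    and Y: "finite Y" "arrows E Y H1 H2" and X: "finite X" and "finite \<T>"
  shows "\<exists>Z lab'. finite Z \<and> forces_blue_neighbours E (insert v H1) H2 Z lab' X lab \<T>"
  using \<open>finite \<T>\<close>
proof (induction \<T>)
  case empty
  have "forces_blue_neighbours E (insert v H1) H2 X lab X lab {}"
    by (rule forces_blue_neighboursI, rule exI[of _ id]) (simp add: graph_embedding_def)
  then show ?case using X by blast
next
  case (insert T \<T>)
  then obtain Z lab' where Z: "finite Z"
    and Z_forces: "forces_blue_neighbours E (insert v H1) H2 Z lab' X lab \<T>" by blast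
  obtain W lab'' where W: "finite W"
    and W_forces: "forces_blue_neighbours E (insert v H1) H2 W lab'' Z lab' {T}"
    using blow_up_step[OF E v Y Z, of lab' T] by blast
  have "\<exists>\<psi>. graph_embedding E E X \<psi> \<and> \<psi> ` X \<subseteq> W \<and> (\<forall>u\<in>X. lab'' (\<psi> u) = lab u) \<and>
        (\<forall>T'\<in>insert T \<T>. \<exists>x\<in>W. blue_neighbour E X \<psi> {u. lab u \<in> T'} c x)"
    if c: "symp c" and no: "\<not> mono_copy E W (insert v H1) c" "\<not> mono_copy E W H2 (\<lambda>x y. \<not> c x y)" for c
  proof -
    obtain \<chi> where \<chi>: "graph_embedding E E Z \<chi>" "\<chi> ` Z \<subseteq> W" "\<forall>u\<in>Z. lab'' (\<chi> u) = lab' u"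
      and "\<forall>T'\<in>{T}. \<exists>x\<in>W. blue_neighbour E Z \<chi> {u. lab' u \<in> T'} c x"
      by (rule forces_blue_neighboursE[OF W_forces c no])
    then obtain x where x: "x \<in> W" "blue_neighbour E Z \<chi> {u. lab' u \<in> T} c x" by blast
    have "symp (\<lambda>x y. c (\<chi> x) (\<chi> y))" using c by (auto simp: symp_def)
    moreover have "\<not> mono_copy E Z (insert v H1) (\<lambda>x y. c (\<chi> x) (\<chi> y))"
      by (rule contrapos_nn[OF no(1)]) (rule mono_copy_transfer[OF _ \<chi>(1,2)])
    moreover have "\<not> mono_copy E Z H2 (\<lambda>x y. \<not> c (\<chi> x) (\<chi> y))"
      by (rule contrapos_nn[OF no(2)]) (rule mono_copy_transfer[OF _ \<chi>(1,2)])
    ultimately obtain \<psi> where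
      \<psi>: "graph_embedding E E X \<psi>" "\<psi> ` X \<subseteq> Z" "\<forall>u\<in>X. lab' (\<psi> u) = lab u"
      "\<forall>T'\<in>\<T>.
         \<exists>x\<in>Z. blue_neighbour E X \<psi> {u. lab u \<in> T'} (\<lambda>x y. c (\<chi> x) (\<chi> y)) x"
      by (rule forces_blue_neighboursE[OF Z_forces])
    have old: "\<exists>x\<in>W. blue_neighbour E X (\<chi> \<circ> \<psi>) {u. lab u \<in> T'} c x" if T': "T' \<in> \<T>" for T'
    proof -
      obtain z where z: "z \<in> Z" "blue_neighbour E X \<psi> {u. lab u \<in> T'} (\<lambda>x y. c (\<chi> x) (\<chi> y)) z"
        using \<psi>(4) T' by blast
      have "\<chi> z \<notin> (\<chi> \<circ> \<psi>) ` X"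
        using z \<chi>(1) \<psi>(2) unfolding blue_neighbour_def graph_embedding_def inj_on_def by auto
      moreover have "E (\<chi> z) (\<chi> (\<psi> u)) \<longleftrightarrow> E z (\<psi> u)" if "u \<in> X" for u
        using z(1) \<chi>(1) \<psi>(2) that unfolding graph_embedding_def by blast
      ultimately have "blue_neighbour E X (\<chi> \<circ> \<psi>) {u. lab u \<in> T'} c (\<chi> z)"
        using z(2) unfolding blue_neighbour_def by simp
      then show ?thesis using z(1) \<chi>(2) by blast
    qed
    have "blue_neighbour E X (\<chi> \<circ> \<psi>) {u. lab u \<in> T} c x"
      using x(2) \<psi>(2,3) unfolding blue_neighbour_def by auto
    moreover have "graph_embedding E E X (\<chi> \<circ> \<psi>)" using graph_embedding_comp[OF \<psi>(1,2) \<chi>(1)] .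
    moreover have "(\<chi> \<circ> \<psi>) ` X \<subseteq> W" "\<forall>u\<in>X. lab'' ((\<chi> \<circ> \<psi>) u) = lab u"
      using \<chi>(2,3) \<psi>(2,3) by (auto simp: image_subset_iff)
    ultimately show ?thesis using old x(1) by (intro exI[of _ "\<chi> \<circ> \<psi>"]) auto
  qed
  then have "forces_blue_neighbours E (insert v H1) H2 W lab'' X lab (insert T \<T>)"
    by (rule forces_blue_neighboursI)
  then show ?case using W by blast
qed

text \<open>Induction on both graphs, with \<open>X\<close> good for \<open>insert v H1, H2\<close> and \<open>Y\<close> good for \<open>H1, insert w H2\<close>.
Blow-ups by \<open>Y\<close>, one for each subset of \<open>X\<close>, force a copy of \<open>X\<close> in which every subset is the blue
neighbourhood of some vertex. A blue \<open>H2\<close> in this copy is then completed by the vertex that belongs to the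
subset of the neighbours of \<open>w\<close>.\<close>

lemma induced_ramsey:
  assumes E: "random_graph E" and "finite H1" "finite H2"
  shows "\<exists>Y. finite Y \<and> arrows E Y H1 H2"
  using assms(2,3)
proof (induction H1 arbitrary: H2)
  case empty
  have "mono_copy E {} {} c" for c by (simp add: mono_copy_def graph_embedding_def)
  then have "arrows E {} {} H2" by (simp add: arrows_def)
  then show ?case by blast
next
  case (insert v H1)
  note outer = insert
  from outer(4) show ?case
  proof (induction H2)
    case empty
    have "mono_copy E {} {} c" for c by (simp add: mono_copy_def graph_embedding_def)
    then have "arrows E {} (insert v H1) {}" by (simp add: arrows_def)
    then show ?case by blast
  next
    case (insert w H2)
    obtain X where X: "finite X" "arrows E X (insert v H1) H2" using insert.IH by blast
    obtain Y where Y: "finite Y" "arrows E Y H1 (insert w H2)"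
      using outer(3)[of "insert w H2"] insert.hyps by blast
    obtain Z lab' where Z: "finite Z"
      and Z_forces: "forces_blue_neighbours E (insert v H1) (insert w H2) Z lab' X id (Pow X)"
      using blow_up_iterated[OF E outer(2) Y X(1), of "Pow X" id] X(1) by auto
    have "mono_copy E Z (insert w H2) (\<lambda>x y. \<not> c x y)"
      if c: "symp c" and no: "\<not> mono_copy E Z (insert v H1) c" for c
    proof (rule ccontr)
      assume no': "\<not> ?thesis"
      obtain \<psi> where \<psi>: "graph_embedding E E X \<psi>" "\<psi> ` X \<subseteq> Z"
        "\<forall>u\<in>X. lab' (\<psi> u) = id u" "\<forall>T\<in>Pow X. \<exists>x\<in>Z. blue_neighbour E X \<psi> {u. id u \<in> T} c x"
        by (rule forces_blue_neighboursE[OF Z_forces c no no'])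
      have nb: "\<exists>x\<in>Z. blue_neighbour E X \<psi> T c x" if "T \<subseteq> X" for T using that \<psi>(4) by auto
      have "symp (\<lambda>x y. c (\<psi> x) (\<psi> y))" using c by (auto simp: symp_def)
      moreover have "\<not> mono_copy E X (insert v H1) (\<lambda>x y. c (\<psi> x) (\<psi> y))"
        by (rule contrapos_nn[OF no]) (rule mono_copy_transfer[OF _ \<psi>(1,2)])
      ultimately have "mono_copy E X H2 (\<lambda>x y. \<not> c (\<psi> x) (\<psi> y))"
        using arrowsD[OF X(2)] by simp
      then obtain \<phi> where \<phi>: "graph_embedding E E H2 \<phi>" "\<phi> ` H2 \<subseteq> X"
        "\<And>x y. x \<in> H2 \<Longrightarrow> y \<in> H2 \<Longrightarrow> E x y \<Longrightarrow> \<not> c (\<psi> (\<phi> x)) (\<psi> (\<phi> y))"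
        unfolding mono_copy_def by blast
      have "\<phi> ` {h\<in>H2. E w h} \<subseteq> X" using \<phi>(2) by blast
      then obtain x where x: "x \<in> Z" "blue_neighbour E X \<psi> (\<phi> ` {h\<in>H2. E w h}) c x"
        using nb by blast
      have trace: "\<phi> h \<in> \<phi> ` {h\<in>H2. E w h} \<longleftrightarrow> E w h" if "h \<in> H2" for h
        using \<phi>(1) that unfolding graph_embedding_def inj_on_def by auto
      have "mono_copy E Z (insert w H2) (\<lambda>x y. \<not> c x y)"
      proof (rule mono_copy_insert[OF E, of _ _ "\<psi> \<circ> \<phi>" _ x])
        show "symp (\<lambda>x y. \<not> c x y)" using c by (auto simp: symp_def)
        show "graph_embedding E E H2 (\<psi> \<circ> \<phi>)" using graph_embedding_comp[OF \<phi>(1,2) \<psi>(1)] .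
        show "x \<notin> (\<psi> \<circ> \<phi>) ` H2" "(\<psi> \<circ> \<phi>) ` H2 \<subseteq> Z"
          using x(2) \<phi>(2) \<psi>(2) unfolding blue_neighbour_def by auto
        show "E x ((\<psi> \<circ> \<phi>) h) \<longleftrightarrow> E w h" if "h \<in> H2" for h
          using x(2) \<phi>(2) trace[OF that] that unfolding blue_neighbour_def by auto
        show "\<not> c x ((\<psi> \<circ> \<phi>) h)" if "h \<in> H2" "E w h" for h
          using x(2) \<phi>(2) that unfolding blue_neighbour_def by auto
      qed (use \<phi>(3) insert.hyps x in auto)
      then show False using no' by blast
    qed
    then show ?case using Z unfolding arrows_def by blast
  qed
qed

text \<open>Single out one colour \<open>a\<close>: where there is no copy of \<open>H\<close> in colour \<open>a\<close> there is a large graph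
whose edges avoid \<open>a\<close>.\<close>

lemma induced_ramsey_finite_colours:
  assumes E: "random_graph E" and "finite C" "finite H"
  shows "\<exists>Y. finite Y \<and> (\<forall>c. (\<forall>x y. c x y = c y x) \<longrightarrow> (\<forall>x\<in>Y. \<forall>y\<in>Y. E x y \<longrightarrow> c x y \<in> C) \<longrightarrow>
           (\<exists>k. mono_copy E Y H (\<lambda>x y. c x y = k)))"
  using \<open>finite C\<close>
proof (induction C)
  case empty
  have "mono_copy E H H (\<lambda>x y. c x y = k)" if "\<forall>x\<in>H. \<forall>y\<in>H. E x y \<longrightarrow> c x y \<in> {}" for c :: "'a \<Rightarrow> 'a \<Rightarrow> 'b" and k
    unfolding mono_copy_def using that by (intro exI[of _ id]) (auto simp: graph_embedding_def)
  then show ?case using \<open>finite H\<close> by (intro exI[of _ H]) simp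
next
  case (insert a C)
  then obtain Y' where Y': "finite Y'" and mono: "\<forall>c. (\<forall>x y. c x y = c y x) \<longrightarrow>
      (\<forall>x\<in>Y'. \<forall>y\<in>Y'. E x y \<longrightarrow> c x y \<in> C) \<longrightarrow> (\<exists>k. mono_copy E Y' H (\<lambda>x y. c x y = k))"
    by (elim exE conjE) (rule that)
  obtain Y where Y: "finite Y" "arrows E Y H Y'" using induced_ramsey[OF E \<open>finite H\<close> Y'] by blast
  have "\<exists>k. mono_copy E Y H (\<lambda>x y. c x y = k)"
    if c: "\<forall>x y. c x y = c y x" "\<forall>x\<in>Y. \<forall>y\<in>Y. E x y \<longrightarrow> c x y \<in> insert a C" for c
  proof (cases "mono_copy E Y H (\<lambda>x y. c x y = a)")
    case False
    have "symp (\<lambda>x y. c x y = a)" using c(1) by (auto simp: symp_def)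
    then have "mono_copy E Y Y' (\<lambda>x y. \<not> c x y = a)" by (rule arrowsD[OF Y(2) _ False])
    then obtain \<phi> where \<phi>: "graph_embedding E E Y' \<phi>" "\<phi> ` Y' \<subseteq> Y"
      "\<And>x y. x \<in> Y' \<Longrightarrow> y \<in> Y' \<Longrightarrow> E x y \<Longrightarrow> c (\<phi> x) (\<phi> y) \<noteq> a"
      unfolding mono_copy_def by blast
    have "c (\<phi> x) (\<phi> y) \<in> C" if xy: "x \<in> Y'" "y \<in> Y'" "E x y" for x y
    proof -
      have "E (\<phi> x) (\<phi> y)" using \<phi>(1) xy unfolding graph_embedding_def by blast
      then show ?thesis using c(2) \<phi>(2) \<phi>(3)[OF xy] xy(1,2) by blast
    qed
    then obtain k where "mono_copy E Y' H (\<lambda>x y. c (\<phi> x) (\<phi> y) = k)"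
      using mono[THEN spec, of "\<lambda>x y. c (\<phi> x) (\<phi> y)"] c(1) by auto
    then have "mono_copy E Y H (\<lambda>x y. c x y = k)"
      by (rule mono_copy_transfer[OF _ \<phi>(1,2)])
    then show ?thesis by blast
  qed blast
  then show ?case using Y(1) by blast
qed

definition nonadjacent :: "('v \<Rightarrow> 'v \<Rightarrow> bool) \<Rightarrow> 'v \<Rightarrow> 'v \<Rightarrow> bool" where
  "nonadjacent E x y \<longleftrightarrow> x \<noteq> y \<and> \<not> E x y"

lemma random_graph_nonadjacent:
  assumes E: "random_graph E"
  shows "random_graph (nonadjacent E)"
  unfolding random_graph_def
proof (intro conjI allI impI)
  show "symp (nonadjacent E)" "irreflp (nonadjacent E)"
    using random_graph_sym[OF E] by (auto simp: nonadjacent_def symp_def irreflp_def)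
  fix U U' :: "'a set" assume U: "finite U" "finite U'" "U \<inter> U' = {}"
  then have "U' \<inter> U = {}" by blast
  with U(2,1) obtain v where "v \<notin> U'" "v \<notin> U" "\<forall>u\<in>U'. E v u" "\<forall>u\<in>U. \<not> E v u"
    by (rule random_graph_extension[OF E])
  then show "\<exists>v. v \<notin> U \<union> U' \<and> (\<forall>u\<in>U. nonadjacent E v u) \<and> (\<forall>u\<in>U'. \<not> nonadjacent E v u)"
    unfolding nonadjacent_def by blast
qed (use E in \<open>auto simp: random_graph_def\<close>)

lemma graph_embedding_nonadjacent:
  assumes E: "random_graph E" and "graph_embedding (nonadjacent E) (nonadjacent E) X \<phi>"
  shows "graph_embedding E E X \<phi>"
  unfolding graph_embedding_def
proof (intro conjI ballI)
  show "inj_on \<phi> X" using assms(2) by (simp add: graph_embedding_def)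
  fix x y assume xy: "x \<in> X" "y \<in> X"
  then have "nonadjacent E x y \<longleftrightarrow> nonadjacent E (\<phi> x) (\<phi> y)" "\<phi> x = \<phi> y \<longleftrightarrow> x = y"
    using assms(2) by (auto simp: graph_embedding_def inj_on_def)
  then show "E x y \<longleftrightarrow> E (\<phi> x) (\<phi> y)"
    using random_graph_irrefl[OF E] unfolding nonadjacent_def by (cases "x = y") auto
qed

text \<open>A graph that works for the edges of \<open>H\<close> is found inside one that works, in the complementary
random graph, for the nonedges of that graph.\<close>

lemma canonical_ramsey:
  assumes E: "random_graph E" and C: "finite C" and H: "finite H"
  shows "\<exists>Y. finite Y \<and> (\<forall>c. (\<forall>x y. c x y = c y x) \<longrightarrow> (\<forall>x y. c x y \<in> C) \<longrightarrow>
     (\<exists>\<phi> k l. graph_embedding E E H \<phi> \<and> \<phi> ` H \<subseteq> Y \<and>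
        (\<forall>x\<in>H. \<forall>y\<in>H. E x y \<longrightarrow> c (\<phi> x) (\<phi> y) = k) \<and>
        (\<forall>x\<in>H. \<forall>y\<in>H. nonadjacent E x y \<longrightarrow> c (\<phi> x) (\<phi> y) = l)))"
proof -
  obtain X where X: "finite X" and X_mono: "\<forall>c. (\<forall>x y. c x y = c y x) \<longrightarrow>
      (\<forall>x\<in>X. \<forall>y\<in>X. E x y \<longrightarrow> c x y \<in> C) \<longrightarrow> (\<exists>k. mono_copy E X H (\<lambda>x y. c x y = k))"
    using induced_ramsey_finite_colours[OF E C H] by (elim exE conjE) (rule that)
  obtain Y where Y: "finite Y" and Y_mono: "\<forall>c. (\<forall>x y. c x y = c y x) \<longrightarrow>
      (\<forall>x\<in>Y. \<forall>y\<in>Y. nonadjacent E x y \<longrightarrow> c x y \<in> C) \<longrightarrow>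
      (\<exists>l. mono_copy (nonadjacent E) Y X (\<lambda>x y. c x y = l))"
    using induced_ramsey_finite_colours[OF random_graph_nonadjacent[OF E] C X]
    by (elim exE conjE) (rule that)
  have "\<exists>\<phi> k l. graph_embedding E E H \<phi> \<and> \<phi> ` H \<subseteq> Y \<and>
        (\<forall>x\<in>H. \<forall>y\<in>H. E x y \<longrightarrow> c (\<phi> x) (\<phi> y) = k) \<and>
        (\<forall>x\<in>H. \<forall>y\<in>H. nonadjacent E x y \<longrightarrow> c (\<phi> x) (\<phi> y) = l)"
    if c: "\<forall>x y. c x y = c y x" "\<forall>x y. c x y \<in> C" for c
  proof -
    obtain l where "mono_copy (nonadjacent E) Y X (\<lambda>x y. c x y = l)" using Y_mono[THEN spec, of c] c by auto
    then obtain \<psi> where \<psi>: "graph_embedding (nonadjacent E) (nonadjacent E) X \<psi>" "\<psi> ` X \<subseteq> Y"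
      "\<And>x y. x \<in> X \<Longrightarrow> y \<in> X \<Longrightarrow> nonadjacent E x y \<Longrightarrow> c (\<psi> x) (\<psi> y) = l"
      unfolding mono_copy_def by blast
    obtain k where "mono_copy E X H (\<lambda>x y. c (\<psi> x) (\<psi> y) = k)"
      using X_mono[THEN spec, of "\<lambda>x y. c (\<psi> x) (\<psi> y)"] c by auto
    then obtain \<phi> where \<phi>: "graph_embedding E E H \<phi>" "\<phi> ` H \<subseteq> X"
      "\<And>x y. x \<in> H \<Longrightarrow> y \<in> H \<Longrightarrow> E x y \<Longrightarrow> c (\<psi> (\<phi> x)) (\<psi> (\<phi> y)) = k"
      unfolding mono_copy_def by blast
    have "graph_embedding E E H (\<psi> \<circ> \<phi>)"
      using graph_embedding_comp[OF \<phi>(1,2) graph_embedding_nonadjacent[OF E \<psi>(1)]] .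
    moreover have "(\<psi> \<circ> \<phi>) ` H \<subseteq> Y" using \<phi>(2) \<psi>(2) by auto
    moreover have "c ((\<psi> \<circ> \<phi>) x) ((\<psi> \<circ> \<phi>) y) = l" if xy: "x \<in> H" "y \<in> H" "nonadjacent E x y" for x y
    proof -
      have "nonadjacent E (\<phi> x) (\<phi> y)"
        using \<phi>(1) xy unfolding graph_embedding_def nonadjacent_def inj_on_def by blast
      then show ?thesis using \<psi>(3) \<phi>(2) xy by auto
    qed
    ultimately show ?thesis using \<phi>(3)
      by (intro exI[of _ "\<psi> \<circ> \<phi>"] exI[of _ k] exI[of _ l]) auto
  qed
  then show ?thesis using Y by blast
qed

section \<open>Locally invertible monoids\<close>

lemma in_pointwise_closureI:
  assumes approx: "\<And>A. finite A \<Longrightarrow> \<exists>g\<in>P. \<forall>a\<in>A. g a = f a"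
  shows "f \<in> pointwise_topology closure_of P"
  unfolding in_closure_of
proof (intro conjI allI impI)
  show "f \<in> topspace pointwise_topology" by (simp add: pointwise_topology_def)
  fix T assume T: "f \<in> T \<and> openin pointwise_topology T"
  then obtain U where U: "finite {i. U i \<noteq> UNIV}" "\<And>i. f i \<in> U i" "Pi\<^sub>E UNIV U \<subseteq> T"
    unfolding pointwise_topology_def openin_product_topology_alt by (auto simp: PiE_iff)
  obtain g where g: "g \<in> P" "\<forall>a\<in>{i. U i \<noteq> UNIV}. g a = f a" using approx[OF U(1)] by blast
  have "g i \<in> U i" for i using g(2) U(2)[of i] by (cases "U i = UNIV") auto
  then have "g \<in> T" using U(3) by (auto simp: PiE_iff)
  then show "\<exists>y. y \<in> P \<and> y \<in> T" using g(1) by blast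
qed

lemma closed_operation_monoid_limit:
  assumes "closed_operation_monoid M" "\<And>A. finite A \<Longrightarrow> \<exists>g\<in>M. \<forall>a\<in>A. g a = f a"
  shows "f \<in> M"
  using in_pointwise_closureI[of M f] assms
  by (simp add: closed_operation_monoid_def closure_of_closedin)

lemma closed_operation_monoid_id: "closed_operation_monoid M \<Longrightarrow> id \<in> M"
  and closed_operation_monoid_comp:
    "closed_operation_monoid M \<Longrightarrow> f \<in> M \<Longrightarrow> g \<in> M \<Longrightarrow> f \<circ> g \<in> M"
  by (simp_all add: closed_operation_monoid_def operation_monoid_def)

definition locally_invertible :: "('v \<Rightarrow> 'v) set \<Rightarrow> bool" where
  "locally_invertible M \<longleftrightarrow> (\<forall>h\<in>M. \<forall>A. finite A \<longrightarrow> (\<exists>h'\<in>M. \<forall>a\<in>A. h' (h a) = a))"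

lemma locally_invertibleE:
  assumes "locally_invertible M" "h \<in> M" "finite A"
  obtains h' where "h' \<in> M" "\<forall>a\<in>A. h' (h a) = a"
  using assms unfolding locally_invertible_def by blast

lemma locally_invertible_permutations_group:
  assumes M: "closed_operation_monoid M" and linv: "locally_invertible M"
  shows "forms_group (permutations_in M)"
  unfolding forms_group_def
proof (rule groupI)
  fix p assume "p \<in> carrier \<lparr>carrier = permutations_in M, mult = (\<circ>), one = id\<rparr>"
  then have p: "p \<in> M" "bij p" by (auto simp: permutations_in_def)
  have "inv_into UNIV p \<in> M"
  proof (rule closed_operation_monoid_limit[OF M])
    fix B :: "'a set" assume "finite B"
    then obtain h' where h': "h' \<in> M" "\<forall>a\<in>inv_into UNIV p ` B. h' (p a) = a"
      using locally_invertibleE[OF linv p(1), of "inv_into UNIV p ` B"] by blast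
    have "h' b = inv_into UNIV p b" if "b \<in> B" for b
      using h'(2) that p(2) by (auto simp: bij_is_surj surj_f_inv_f)
    then show "\<exists>g\<in>M. \<forall>b\<in>B. g b = inv_into UNIV p b" using h'(1) by blast
  qed
  moreover have "inv_into UNIV p \<circ> p = id" using p(2) by (simp add: bij_is_inj)
  ultimately show "\<exists>q\<in>carrier \<lparr>carrier = permutations_in M, mult = (\<circ>), one = id\<rparr>.
      q \<otimes>\<^bsub>\<lparr>carrier = permutations_in M, mult = (\<circ>), one = id\<rparr>\<^esub> p =
      \<one>\<^bsub>\<lparr>carrier = permutations_in M, mult = (\<circ>), one = id\<rparr>\<^esub>"
    using p(2) by (auto simp: permutations_in_def bij_imp_bij_inv)
next
  show "\<one>\<^bsub>\<lparr>carrier = permutations_in M, mult = (\<circ>), one = id\<rparr>\<^esub>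
      \<in> carrier \<lparr>carrier = permutations_in M, mult = (\<circ>), one = id\<rparr>"
    using closed_operation_monoid_id[OF M] by (simp add: permutations_in_def)
qed (simp_all add: permutations_in_def bij_comp comp_assoc closed_operation_monoid_comp[OF M])

text \<open>The admissible partial maps are the finite restrictions of operations in \<open>M\<close>. Going forth is trivial.
To hit a given \<open>y\<close>, invert \<open>g\<close> on the domain by \<open>g'\<close> and then \<open>g'\<close> on the range and \<open>y\<close> by \<open>g''\<close>:
the operation \<open>g''\<close> agrees with \<open>g\<close> on the domain and maps \<open>g' y\<close> to \<open>y\<close>.\<close>

lemma locally_invertible_permutations_dense:
  fixes M :: "('v \<Rightarrow> 'v) set"
  assumes count: "countable (UNIV :: 'v set)"
    and M: "closed_operation_monoid M" and linv: "locally_invertible M"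
  shows "dense_subset (permutations_in M) M"
  unfolding dense_subset_def
proof (intro conjI subsetI)
  fix h assume h: "h \<in> M"
  define Q :: "('v \<times> 'v) set \<Rightarrow> bool"
    where "Q p \<longleftrightarrow> finite p \<and> (\<exists>g\<in>M. \<forall>x y. (x, y) \<in> p \<longrightarrow> g x = y)" for p
  show "h \<in> pointwise_topology closure_of permutations_in M"
  proof (rule in_pointwise_closureI)
    fix A :: "'v set" assume "finite A"
    have start: "Q ((\<lambda>a. (a, h a)) ` A)" using h \<open>finite A\<close> by (auto simp: Q_def)
    have "\<exists>f. bij f \<and> (\<forall>(x, y)\<in>(\<lambda>a. (a, h a)) ` A. f x = y) \<and>
             (\<forall>A. finite A \<longrightarrow> (\<exists>p. Q p \<and> (\<forall>a\<in>A. (a, f a) \<in> p)))"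
    proof (rule back_and_forth[where Q = Q, OF count start])
      show "y = z" if "Q p" "(x, y) \<in> p" "(x, z) \<in> p" for p x y z
        using that unfolding Q_def by blast
      show "x = y" if p: "Q p" "(x, z) \<in> p" "(y, z) \<in> p" for p x y z
      proof -
        obtain g where g: "g \<in> M" "g x = z" "g y = z" using p unfolding Q_def by blast
        obtain g' where "\<forall>a\<in>{x, y}. g' (g a) = a"
          using locally_invertibleE[OF linv g(1), of "{x, y}"] by blast
        then show ?thesis using g by auto
      qed
      show "\<exists>y. Q (insert (x, y) p)" if p: "Q p" for p x
      proof -
        obtain g where "g \<in> M" "\<forall>x y. (x, y) \<in> p \<longrightarrow> g x = y" using p unfolding Q_def by blast
        then have "Q (insert (x, g x) p)" using p unfolding Q_def by auto
        then show ?thesis ..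
      qed
      show "\<exists>x. Q (insert (x, y) p)" if p: "Q p" for p y
      proof -
        have fin: "finite p" using p by (simp add: Q_def)
        obtain g where g: "g \<in> M" "\<And>x y. (x, y) \<in> p \<Longrightarrow> g x = y" using p unfolding Q_def by blast
        obtain g' where g': "g' \<in> M" "\<forall>a\<in>Domain p. g' (g a) = a"
          using locally_invertibleE[OF linv g(1) finite_Domain[OF fin]] .
        obtain g'' where g'': "g'' \<in> M" "\<forall>b\<in>insert y (Range p). g'' (g' b) = b"
          using locally_invertibleE[OF linv g'(1), of "insert y (Range p)"] finite_Range[OF fin] by blast
        have "g'' a = b" if ab: "(a, b) \<in> p" for a b
        proof -
          have "g' b = a" using g'(2) g(2)[OF ab] ab by (metis DomainI)
          then show ?thesis using g''(2) ab by (metis RangeI insertCI)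
        qed
        moreover have "g'' (g' y) = y" using g''(2) by blast
        ultimately have "Q (insert (g' y, y) p)" using fin g''(1) unfolding Q_def by auto
        then show ?thesis ..
      qed
    qed
    then obtain f where f: "bij f" "\<forall>a\<in>A. f a = h a"
      "\<And>A. finite A \<Longrightarrow> \<exists>p. Q p \<and> (\<forall>a\<in>A. (a, f a) \<in> p)" by auto
    have "f \<in> M"
    proof (rule closed_operation_monoid_limit[OF M])
      fix B :: "'v set" assume "finite B"
      then obtain p where p: "Q p" "\<forall>a\<in>B. (a, f a) \<in> p" using f(3) by blast
      then show "\<exists>g\<in>M. \<forall>a\<in>B. g a = f a" unfolding Q_def by blast
    qed
    then show "\<exists>f\<in>permutations_in M. \<forall>a\<in>A. f a = h a" using f by (auto simp: permutations_in_def)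
  qed
qed (simp add: permutations_in_def)

section \<open>Monoids that are not locally invertible\<close>

text \<open>The type of \<open>g\<close> on \<open>Y\<close>, that is, its kernel and the edges of its image, determines \<open>g\<close> on \<open>Y\<close> up to
an automorphism, and there are finitely many types. If the set of types reachable from \<open>g\<close> has least
cardinality, composing with any \<open>h\<close> does not shrink it, so the type of \<open>g\<close> itself remains reachable.\<close>

lemma recurrent_operation:
  assumes E: "random_graph E" and M: "closed_operation_monoid M"
    and aut: "graph_automorphisms E \<subseteq> M" and Y: "finite Y"
  shows "\<exists>g\<in>M. \<forall>h\<in>M. \<exists>h'\<in>M. \<forall>x\<in>Y. h' (h (g x)) = g x"
proof -
  define ty where "ty g = ({(x, y) \<in> Y \<times> Y. g x = g y}, {(x, y) \<in> Y \<times> Y. E (g x) (g y)})"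
    for g :: "'a \<Rightarrow> 'a"
  define reach where "reach g = (\<lambda>h. ty (h \<circ> g)) ` M" for g
  have fin: "finite (reach g)" for g
  proof (rule finite_subset)
    show "reach g \<subseteq> Pow (Y \<times> Y) \<times> Pow (Y \<times> Y)" by (auto simp: reach_def ty_def)
  qed (use Y in simp)
  obtain g where g: "g \<in> M" and least: "\<And>g'. g' \<in> M \<Longrightarrow> card (reach g) \<le> card (reach g')"
    using ex_has_least_nat[of "\<lambda>g. g \<in> M" id "\<lambda>g. card (reach g)"]
      closed_operation_monoid_id[OF M] by blast
  have "\<exists>h'\<in>M. \<forall>x\<in>Y. h' (h (g x)) = g x" if h: "h \<in> M" for h
  proof -
    have hg: "h \<circ> g \<in> M" using closed_operation_monoid_comp[OF M h g] .
    have "reach (h \<circ> g) \<subseteq> reach g"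
    proof
      fix t assume "t \<in> reach (h \<circ> g)"
      then obtain h1 where "h1 \<in> M" "t = ty ((h1 \<circ> h) \<circ> g)" by (auto simp: reach_def comp_assoc)
      then show "t \<in> reach g"
        using closed_operation_monoid_comp[OF M _ h] unfolding reach_def by blast
    qed
    then have "reach (h \<circ> g) = reach g" using card_seteq[OF fin] least[OF hg] by blast
    moreover have "ty g \<in> reach g"
      using closed_operation_monoid_id[OF M] unfolding reach_def by (metis id_comp imageI)
    ultimately obtain h1 where h1: "h1 \<in> M" "ty g = ty (h1 \<circ> (h \<circ> g))"
      unfolding reach_def by blast
    have "(h1 (h (g x)) = h1 (h (g y)) \<longleftrightarrow> g x = g y) \<and>
          (E (h1 (h (g x))) (h1 (h (g y))) \<longleftrightarrow> E (g x) (g y))" if "x \<in> Y" "y \<in> Y" for x y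
      using h1(2) that unfolding ty_def by (auto simp: set_eq_iff)
    then obtain \<alpha> where "\<alpha> \<in> graph_automorphisms E" "\<forall>x\<in>Y. \<alpha> (h1 (h (g x))) = g x"
      using random_graph_homogeneous[OF E Y, of "\<lambda>x. h1 (h (g x))" g] by blast
    moreover from this have "\<alpha> \<circ> h1 \<in> M" using closed_operation_monoid_comp[OF M _ h1(1)] aut by blast
    ultimately show ?thesis by (intro bexI[of _ "\<alpha> \<circ> h1"]) auto
  qed
  then show ?thesis using g by blast
qed

lemma random_graph_induced_path:
  assumes R: "random_graph R"
  shows "\<exists>p q r. R p q \<and> R q r \<and> r \<noteq> p \<and> \<not> R p r"
proof -
  fix p
  obtain q where q: "R q p" using random_graph_extension[OF R, of "{p}" "{}"] by auto
  have "finite {q}" "finite {p}" "{q} \<inter> {p} = {}" using q random_graph_irrefl[OF R] by auto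
  then obtain r where r: "r \<notin> {q}" "r \<notin> {p}" "\<forall>u\<in>{q}. R r u" "\<forall>u\<in>{p}. \<not> R r u"
    by (rule random_graph_extension[OF R])
  have "R p q" "R q r" "r \<noteq> p" "\<not> R p r"
    using q r(2-4) random_graph_sym[OF R, of r] random_graph_sym[OF R, of q p] by auto
  then show ?thesis by blast
qed

text \<open>If the image of \<open>g\<close> contained a copy of \<open>A\<close>, an automorphism \<open>\<beta>\<close> would move it to \<open>A\<close>, and an
operation \<open>h'\<close> undoing \<open>h0 \<circ> \<beta>\<close> on the image of \<open>g\<close> would make \<open>\<beta> \<circ> h'\<close> undo \<open>h0\<close> on \<open>A\<close>.\<close>

lemma recurrent_image_omits_noninvertible:
  assumes E: "random_graph E" and M: "closed_operation_monoid M"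
    and aut: "graph_automorphisms E \<subseteq> M"
    and h0: "h0 \<in> M" and A: "finite A" and no_inverse: "\<forall>h'\<in>M. \<exists>a\<in>A. h' (h0 a) \<noteq> a"
    and rec: "\<forall>h\<in>M. \<exists>h'\<in>M. \<forall>x\<in>Y. h' (h (g x)) = g x"
    and \<xi>: "\<xi> ` A \<subseteq> Y"
  shows "\<not> graph_embedding E E A (g \<circ> \<xi>)"
proof
  assume "graph_embedding E E A (g \<circ> \<xi>)"
  then obtain \<beta> where "\<beta> \<in> graph_automorphisms E" and \<beta>: "\<forall>a\<in>A. \<beta> (g (\<xi> a)) = a"
    using random_graph_homogeneous[OF E A, of "\<lambda>a. g (\<xi> a)" "\<lambda>a. a"]
    by (auto simp: graph_embedding_def inj_on_def)
  then have "\<beta> \<in> M" using aut by blast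
  then have "h0 \<circ> \<beta> \<in> M" by (rule closed_operation_monoid_comp[OF M h0])
  then obtain h' where h': "h' \<in> M" "\<forall>x\<in>Y. h' ((h0 \<circ> \<beta>) (g x)) = g x" using rec by blast
  have "(\<beta> \<circ> h') (h0 a) = a" if a: "a \<in> A" for a
  proof -
    have "\<xi> a \<in> Y" using \<xi> a by blast
    then have "h' ((h0 \<circ> \<beta>) (g (\<xi> a))) = g (\<xi> a)" using h'(2) by blast
    then show ?thesis using \<beta> a by simp
  qed
  moreover have "\<beta> \<circ> h' \<in> M" by (rule closed_operation_monoid_comp[OF M \<open>\<beta> \<in> M\<close> h'(1)])
  ultimately show False using no_inverse by blast
qed

text \<open>The values \<open>0\<close>, \<open>1\<close>, \<open>2\<close> correspond to constant operations, to \<open>e_E\<close> and to \<open>e_N\<close>: each of these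
has a single type on all pairs of distinct vertices.\<close>

definition pair_type :: "('v \<Rightarrow> 'v \<Rightarrow> bool) \<Rightarrow> 'v \<Rightarrow> 'v \<Rightarrow> nat" where
  "pair_type E x y = (if x = y then 0 else if E x y then 1 else 2)"

lemma pair_type_simps:
  "pair_type E x y = 0 \<longleftrightarrow> x = y"
  "pair_type E x y = 1 \<longleftrightarrow> x \<noteq> y \<and> E x y"
  "pair_type E x y = Suc 0 \<longleftrightarrow> x \<noteq> y \<and> E x y"
  "pair_type E x y = 2 \<longleftrightarrow> x \<noteq> y \<and> \<not> E x y"
  "pair_type E x y \<in> {0, 1, 2}"
  by (simp_all add: pair_type_def)

lemma graph_embedding_offdiagonalI:
  assumes E: "random_graph E"
    and off: "\<And>x y. x \<in> A \<Longrightarrow> y \<in> A \<Longrightarrow> x \<noteq> y \<Longrightarrow> f x \<noteq> f y \<and> (E x y \<longleftrightarrow> E (f x) (f y))"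
  shows "graph_embedding E E A f"
  unfolding graph_embedding_def
proof (intro conjI ballI)
  show "inj_on f A" using off by (meson inj_onI)
  show "E x y \<longleftrightarrow> E (f x) (f y)" if "x \<in> A" "y \<in> A" for x y
    using off[OF that] random_graph_irrefl[OF E] by (cases "x = y") auto
qed

text \<open>The heart of the matter: outside the locally invertible case, every finite set has a homogeneous
image. It is obtained from a recurrent operation on a set \<open>Y\<close> that is Ramsey for \<open>K\<close>. Besides \<open>H\<close>,
the graph \<open>K\<close> contains what refutes every behaviour that treats edges and nonedges differently.\<close>

lemma homogeneous_image:
  fixes M :: "('v \<Rightarrow> 'v) set"
  assumes E: "random_graph E" and M: "closed_operation_monoid M"
    and aut: "graph_automorphisms E \<subseteq> M" and not_inv: "\<not> locally_invertible M" and H: "finite H"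
  shows "\<exists>g\<in>M. \<exists>k\<in>{0, 1, 2}. \<forall>x\<in>H. \<forall>y\<in>H. x \<noteq> y \<longrightarrow> pair_type E (g x) (g y) = k"
proof -
  note co = random_graph_nonadjacent[OF E]
  have "\<exists>h0\<in>M. \<exists>A. finite A \<and> (\<forall>h'\<in>M. \<exists>a\<in>A. h' (h0 a) \<noteq> a)"
    using not_inv unfolding locally_invertible_def by simp
  then obtain h0 A where h0: "h0 \<in> M" and A: "finite A"
    and no_inverse: "\<forall>h'\<in>M. \<exists>a\<in>A. h' (h0 a) \<noteq> a"
    by (elim exE bexE conjE) (rule that)
  have "symp (nonadjacent E)" "irreflp (nonadjacent E)" using co by (simp_all add: random_graph_def)
  then obtain \<theta> where \<theta>: "graph_embedding (nonadjacent E) E A \<theta>"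
    using random_graph_universal[OF E A] by blast
  obtain p q r where pqr: "E p q" "E q r" "r \<noteq> p" "\<not> E p r"
    using random_graph_induced_path[OF E] by blast
  obtain p' q' r' where pqr': "nonadjacent E p' q'" "nonadjacent E q' r'" "r' \<noteq> p'" "\<not> nonadjacent E p' r'"
    using random_graph_induced_path[OF co] by blast
  \<comment> \<open>The complement of \<open>A\<close> deals with operations that exchange edges and nonedges, the two
    triples with operations that collapse one of the two kinds of pairs.\<close>
  define K where "K = H \<union> A \<union> \<theta> ` A \<union> {p, q, r, p', q', r'}"
  have K: "finite K" using H A by (simp add: K_def)
  have fin3: "finite {0, 1, 2 :: nat}" by simp
  obtain Y where Y: "finite Y" and can: "\<forall>c. (\<forall>x y. c x y = c y x) \<longrightarrow> (\<forall>x y. c x y \<in> {0, 1, 2 :: nat}) \<longrightarrow>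
     (\<exists>\<phi> k l. graph_embedding E E K \<phi> \<and> \<phi> ` K \<subseteq> Y \<and>
        (\<forall>x\<in>K. \<forall>y\<in>K. E x y \<longrightarrow> c (\<phi> x) (\<phi> y) = k) \<and>
        (\<forall>x\<in>K. \<forall>y\<in>K. nonadjacent E x y \<longrightarrow> c (\<phi> x) (\<phi> y) = l))"
    using canonical_ramsey[OF E fin3 K] by (elim exE conjE) (rule that)
  obtain g where g: "g \<in> M" and rec: "\<forall>h\<in>M. \<exists>h'\<in>M. \<forall>x\<in>Y. h' (h (g x)) = g x"
    using recurrent_operation[OF E M aut Y] by blast
  define c where "c x y = pair_type E (g x) (g y)" for x y
  have "\<forall>x y. c x y = c y x" using random_graph_sym[OF E] by (auto simp: c_def pair_type_def)
  moreover have "\<forall>x y. c x y \<in> {0, 1, 2}" by (simp add: c_def pair_type_def)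
  ultimately have "\<exists>\<phi> k l. graph_embedding E E K \<phi> \<and> \<phi> ` K \<subseteq> Y \<and>
        (\<forall>x\<in>K. \<forall>y\<in>K. E x y \<longrightarrow> c (\<phi> x) (\<phi> y) = k) \<and>
        (\<forall>x\<in>K. \<forall>y\<in>K. nonadjacent E x y \<longrightarrow> c (\<phi> x) (\<phi> y) = l)"
    by (rule can[THEN spec, THEN mp, THEN mp])
  then obtain \<phi> k l where \<phi>: "graph_embedding E E K \<phi>" "\<phi> ` K \<subseteq> Y"
    and edges: "\<forall>x\<in>K. \<forall>y\<in>K. E x y \<longrightarrow> c (\<phi> x) (\<phi> y) = k"
    and nonedges: "\<forall>x\<in>K. \<forall>y\<in>K. nonadjacent E x y \<longrightarrow> c (\<phi> x) (\<phi> y) = l"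
    by (elim exE conjE) (rule that)
  have k: "pair_type E (g (\<phi> x)) (g (\<phi> y)) = k" if "x \<in> K" "y \<in> K" "E x y" for x y
    using edges that unfolding c_def by blast
  have l: "pair_type E (g (\<phi> x)) (g (\<phi> y)) = l" if "x \<in> K" "y \<in> K" "x \<noteq> y" "\<not> E x y" for x y
    using nonedges that unfolding c_def nonadjacent_def by blast
  have inK: "p \<in> K" "q \<in> K" "r \<in> K" "p' \<in> K" "q' \<in> K" "r' \<in> K" "A \<subseteq> K" "\<theta> ` A \<subseteq> K" "H \<subseteq> K"
    by (auto simp: K_def)
  have "p' \<noteq> q'" "\<not> E p' q'" "q' \<noteq> r'" "\<not> E q' r'" "E p' r'"
    using pqr' by (simp_all add: nonadjacent_def)
  note path_types = k[OF inK(1,2) pqr(1)] k[OF inK(2,3) pqr(2)] l[OF inK(1,3) pqr(3)[symmetric] pqr(4)]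
    l[OF inK(4,5) this(1,2)] l[OF inK(5,6) this(3,4)] k[OF inK(4,6) this(5)]
  note no_copy = recurrent_image_omits_noninvertible[OF E M aut h0 A no_inverse rec]
  have range: "k \<in> {0, 1, 2}" "l \<in> {0, 1, 2}"
    using pair_type_simps(5)[of E] path_types(1,3) by metis+
  \<comment> \<open>Here \<open>g\<close> preserves edges and nonedges on the copy of \<open>K\<close>, in the next case it exchanges them.\<close>
  have "\<not> (k = 1 \<and> l = 2)"
  proof
    assume kl: "k = 1 \<and> l = 2"
    have "\<phi> ` A \<subseteq> Y" using \<phi>(2) inK(7) by blast
    moreover have "g (\<phi> x) \<noteq> g (\<phi> y) \<and> (E x y \<longleftrightarrow> E (g (\<phi> x)) (g (\<phi> y)))"
      if "x \<in> A" "y \<in> A" "x \<noteq> y" for x y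
    proof -
      have xy: "x \<in> K" "y \<in> K" using that inK(7) by blast+
      show ?thesis using k[OF xy] l[OF xy that(3)] kl by (cases "E x y") (auto simp: pair_type_simps)
    qed
    then have "graph_embedding E E A (g \<circ> \<phi>)"
      by (intro graph_embedding_offdiagonalI[OF E]) simp
    ultimately show False using no_copy by blast
  qed
  moreover have "\<not> (k = 2 \<and> l = 1)"
  proof
    assume kl: "k = 2 \<and> l = 1"
    have "(\<phi> \<circ> \<theta>) ` A \<subseteq> Y" using \<phi>(2) inK(8) by auto
    moreover have "g (\<phi> (\<theta> x)) \<noteq> g (\<phi> (\<theta> y)) \<and> (E x y \<longleftrightarrow> E (g (\<phi> (\<theta> x))) (g (\<phi> (\<theta> y))))"
      if "x \<in> A" "y \<in> A" "x \<noteq> y" for x y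
    proof -
      have xy: "\<theta> x \<in> K" "\<theta> y \<in> K" using that inK(8) by blast+
      have "\<theta> x \<noteq> \<theta> y" "E (\<theta> x) (\<theta> y) \<longleftrightarrow> \<not> E x y"
        using \<theta> that unfolding graph_embedding_def inj_on_def nonadjacent_def by blast+
      then show ?thesis using k[OF xy] l[OF xy] kl by (cases "E x y") (auto simp: pair_type_simps)
    qed
    then have "graph_embedding E E A (g \<circ> (\<phi> \<circ> \<theta>))"
      by (intro graph_embedding_offdiagonalI[OF E]) simp
    ultimately show False using no_copy by blast
  qed
  moreover have "l = 0" if "k = 0"
  proof -
    have "g (\<phi> p) = g (\<phi> q)" "g (\<phi> q) = g (\<phi> r)"
      using path_types(1,2) unfolding that pair_type_simps(1) .
    then show ?thesis using path_types(3) by (simp add: pair_type_def)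
  qed
  moreover have "k = 0" if "l = 0"
  proof -
    have "g (\<phi> p') = g (\<phi> q')" "g (\<phi> q') = g (\<phi> r')"
      using path_types(4,5) unfolding that pair_type_simps(1) .
    then show ?thesis using path_types(6) by (simp add: pair_type_def)
  qed
  ultimately have "k = l" using range by auto
  have type: "pair_type E (g (\<phi> x)) (g (\<phi> y)) = k" if "x \<in> H" "y \<in> H" "x \<noteq> y" for x y
    using k[of x y] l[of x y] \<open>k = l\<close> that inK(9) by blast
  have "x \<in> K \<Longrightarrow> y \<in> K \<Longrightarrow> (x = y \<longleftrightarrow> \<phi> x = \<phi> y) \<and> (E x y \<longleftrightarrow> E (\<phi> x) (\<phi> y))" for x y
    using \<phi>(1) unfolding graph_embedding_def inj_on_def by blast
  then obtain \<alpha> where "\<alpha> \<in> graph_automorphisms E" and \<alpha>: "\<forall>x\<in>K. \<alpha> x = \<phi> x"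
    using random_graph_homogeneous[OF E K, of "\<lambda>x. x" \<phi>] by blast
  then have "\<alpha> \<in> M" using aut by blast
  then have "g \<circ> \<alpha> \<in> M" by (rule closed_operation_monoid_comp[OF M g])
  moreover have "(g \<circ> \<alpha>) x = g (\<phi> x)" if "x \<in> H" for x using \<alpha> that inK(9) by auto
  ultimately show ?thesis using type range(1)
    by (intro bexI[of _ "g \<circ> \<alpha>"] bexI[of _ k]) simp_all
qed

definition same_type_on ::
    "('v \<Rightarrow> 'v \<Rightarrow> bool) \<Rightarrow> 'v set \<Rightarrow> ('v \<Rightarrow> 'v) \<Rightarrow> ('v \<Rightarrow> 'v) \<Rightarrow> bool" where
  "same_type_on E A f g \<longleftrightarrow> (\<forall>x\<in>A. \<forall>y\<in>A. x \<noteq> y \<longrightarrow> pair_type E (f x) (f y) = pair_type E (g x) (g y))"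

text \<open>The type of an operation on a finite set determines it there up to an automorphism.\<close>

lemma operation_in_monoid_if_same_type:
  assumes E: "random_graph E" and M: "closed_operation_monoid M"
    and aut: "graph_automorphisms E \<subseteq> M"
    and types: "\<And>A. finite A \<Longrightarrow> \<exists>g\<in>M. same_type_on E A g f"
  shows "f \<in> M"
proof (rule closed_operation_monoid_limit[OF M])
  fix A :: "'a set" assume A: "finite A"
  obtain g where g: "g \<in> M" "same_type_on E A g f" using types[OF A] by blast
  have "(g x = g y \<longleftrightarrow> f x = f y) \<and> (E (g x) (g y) \<longleftrightarrow> E (f x) (f y))" if xy: "x \<in> A" "y \<in> A" for x y
  proof (cases "x = y")
    case True
    then show ?thesis using random_graph_irrefl[OF E] by simp
  next
    case False
    then have "pair_type E (g x) (g y) = pair_type E (f x) (f y)"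
      using g(2) xy unfolding same_type_on_def by blast
    then show ?thesis
      using random_graph_irrefl[OF E] by (auto simp: pair_type_def split: if_splits)
  qed
  then obtain \<alpha> where "\<alpha> \<in> graph_automorphisms E" and \<alpha>: "\<forall>x\<in>A. \<alpha> (g x) = f x"
    using random_graph_homogeneous[OF E A, of g f] by blast
  then have "\<alpha> \<in> M" using aut by blast
  then have "\<alpha> \<circ> g \<in> M" using g(1) by (rule closed_operation_monoid_comp[OF M])
  then show "\<exists>h\<in>M. \<forall>a\<in>A. h a = f a" using \<alpha> by (intro bexI[of _ "\<alpha> \<circ> g"]) simp_all
qed

theorem theorem7:
  fixes E :: "'v \<Rightarrow> 'v \<Rightarrow> bool"
    and e_E e_N :: "'v \<Rightarrow> 'v"
    and M :: "('v \<Rightarrow> 'v) set"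
  assumes "random_graph E"
    and "inj e_E" and "induces_complete E (range e_E)"
    and "inj e_N" and "independent_set E (range e_N)"
    and "closed_operation_monoid M"
    and "graph_automorphisms E \<subseteq> M"
  shows "(\<exists>c. (\<lambda>_. c) \<in> M) \<or>
         e_E \<in> M \<or>
         e_N \<in> M \<or>
         (forms_group (permutations_in M) \<and> dense_subset (permutations_in M) M)"
proof (cases "locally_invertible M")
  case True
  moreover have "countable (UNIV :: 'v set)" using assms(1) by (simp add: random_graph_def)
  ultimately show ?thesis
    using locally_invertible_permutations_group[OF assms(6)]
      locally_invertible_permutations_dense[OF _ assms(6)] by blast
next
  case False
  \<comment> \<open>Indexing the three target operations by their type on pairs treats them uniformly.\<close>
  define f :: "nat \<Rightarrow> 'v \<Rightarrow> 'v" where "f k = (if k = 0 then \<lambda>_. undefined else if k = 1 then e_E else e_N)" for k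
  have type: "pair_type E (f k x) (f k y) = k" if "x \<noteq> y" "k \<in> {0, 1, 2}" for k x y
    using that assms(2-5)
    by (auto simp: f_def pair_type_def induces_complete_def independent_set_def inj_eq)
  have "\<exists>k\<in>{0, 1, 2}. f k \<in> M"
  proof (rule ccontr)
    assume "\<not> ?thesis"
    then have "\<exists>A. finite A \<and> (\<forall>g\<in>M. \<not> same_type_on E A g (f k))" if "k \<in> {0, 1, 2}" for k
      using operation_in_monoid_if_same_type[OF assms(1,6,7), of "f k"] that by blast
    then obtain A where A: "\<And>k. k \<in> {0, 1, 2} \<Longrightarrow> finite (A k)"
      and fail: "\<And>k g. k \<in> {0, 1, 2} \<Longrightarrow> g \<in> M \<Longrightarrow> \<not> same_type_on E (A k) g (f k)"
      by metis
    \<comment> \<open>If each target operation fails on some finite set, then all three fail on the union.\<close>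
    have "finite (\<Union>k\<in>{0, 1, 2}. A k)" using A by blast
    then obtain g k where g: "g \<in> M" and k: "k \<in> {0, 1, 2}"
      and gk: "\<forall>x\<in>\<Union>k\<in>{0, 1, 2}. A k. \<forall>y\<in>\<Union>k\<in>{0, 1, 2}. A k. x \<noteq> y \<longrightarrow> pair_type E (g x) (g y) = k"
      using homogeneous_image[OF assms(1,6,7) False] by meson
    have "same_type_on E (A k) g (f k)"
      unfolding same_type_on_def
    proof (intro ballI impI)
      fix x y assume xy: "x \<in> A k" "y \<in> A k" "x \<noteq> y"
      then have "x \<in> (\<Union>k\<in>{0, 1, 2}. A k)" "y \<in> (\<Union>k\<in>{0, 1, 2}. A k)" using k by blast+
      then have "pair_type E (g x) (g y) = k" using gk xy(3) by blast
      then show "pair_type E (g x) (g y) = pair_type E (f k x) (f k y)" using type[OF xy(3) k] by simp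
    qed
    then show False using fail[OF k g] by blast
  qed
  then consider "f 0 \<in> M" | "f 1 \<in> M" | "f 2 \<in> M" by blast
  then show ?thesis
    by cases (auto simp: f_def)
qed

end
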